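(* Let $\varphi$ be a quantifier-free $\mathcal{T}$-formula and $\boldsymbol{\alpha}$ a finite set of atoms containing all atoms of $\varphi$. Let $\{C_1,\ldots,C_K\}$ be a set of $\mathcal{T}$-lemmas on $\boldsymbol{\alpha}$ which rules out $P_{\boldsymbol{\alpha}}(\varphi)$, and let $\mathrm{Tred}(\varphi)=\varphi\wedge\bigwedge_{l=1}^K C_l$. Then (i) $\mathrm{Tred}(\varphi)\equiv_{\mathcal{T}}\varphi$; (ii) $\mathrm{Tred}(\varphi)\models_p\varphi$; (iii) $\mathrm{Tred}(\varphi)$ is $\mathcal{T}$-reduced with respect to $\boldsymbol{\alpha}$.
   Context: $\mathcal{T}$-formulas are quantifier-free formulas built by Boolean connectives from $\mathcal{T}$-atoms and Boolean atoms. The Boolean abstraction maps each atom bijectively to a Boolean variable; $\varphi\models_p\psi$ means the Boolean abstraction of $\varphi$ entails that of $\psi$ propositionally. $\equiv_{\mathcal{T}}$ is equivalence modulo $\mathcal{T}$. A $\mathcal{T}$-lemma is a $\mathcal{T}$-valid clause. A total truth assignment on $\boldsymbol{\alpha}$ is a conjunction containing, for each $a\in\boldsymbol{\alpha}$, exactly one of $a,\neg a$. $P_{\boldsymbol{\alpha}}(\psi)$ is the set of $\mathcal{T}$-unsatisfiable total truth assignments $\rho$ on $\boldsymbol{\alpha}$ with $\rho\models_p\psi$. A set of $\mathcal{T}$-lemmas $\{C_1,\dots,C_K\}$ rules out a set $\{\rho_1,\dots,\rho_M\}$ of $\mathcal{T}$-unsatisfiable total truth assignments iff for every $\rho_j$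 there is some $C_l$ with $\rho_j\models_p\neg C_l$. A formula $\psi$ is $\mathcal{T}$-reduced with respect to $\boldsymbol{\alpha}$ iff $P_{\boldsymbol{\alpha}}(\psi)=\emptyset$. *)

theory Defs
  imports Main
begin

section \<open>Quantifier-free formulas over a theory\<close>

datatype ('f, 'v) trm = Var 'v | Fun 'f "('f, 'v) trm list"

text \<open>
  As symbols are applied to argument lists, a symbol used with different numbers of
  arguments acts as several unrelated symbols, one for each arity.
\<close>
datatype ('f, 'r, 'v) theory_atom =
    Rel 'r "('f, 'v) trm list"
  | Eq "('f, 'v) trm" "('f, 'v) trm"

datatype ('f, 'r, 'v, 'b) atom =
    TAtom "('f, 'r, 'v) theory_atom"
  | BAtom 'b

datatype (atoms_of: 'a) form =
    TT
  | FF
  | Atom 'a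
  | Neg "'a form"
  | And "'a form" "'a form"
  | Or "'a form" "'a form"
  | Imp "'a form" "'a form"
  | Iff "'a form" "'a form"

type_synonym ('f, 'r, 'v, 'b) tform = "('f, 'r, 'v, 'b) atom form"

primrec eval :: "('a \<Rightarrow> bool) \<Rightarrow> 'a form \<Rightarrow> bool" where
  "eval \<mu> TT \<longleftrightarrow> True"
| "eval \<mu> FF \<longleftrightarrow> False"
| "eval \<mu> (Atom a) \<longleftrightarrow> \<mu> a"
| "eval \<mu> (Neg F) \<longleftrightarrow> \<not> eval \<mu> F"
| "eval \<mu> (And F G) \<longleftrightarrow> eval \<mu> F \<and> eval \<mu> G"
| "eval \<mu> (Or F G) \<longleftrightarrow> eval \<mu> F \<or> eval \<mu> G"
| "eval \<mu> (Imp F G) \<longleftrightarrow> (eval \<mu> F \<longrightarrow> eval \<mu> G)"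
| "eval \<mu> (Iff F G) \<longleftrightarrow> (eval \<mu> F \<longleftrightarrow> eval \<mu> G)"

definition Conj :: "'a form list \<Rightarrow> 'a form" where
  "Conj Fs = foldr And Fs TT"

definition Disj :: "'a form list \<Rightarrow> 'a form" where
  "Disj Fs = foldr Or Fs FF"

definition literal :: "'a form \<Rightarrow> bool" where
  "literal L \<longleftrightarrow> (\<exists>a. L = Atom a \<or> L = Neg (Atom a))"

definition clause :: "'a form \<Rightarrow> bool" where
  "clause C \<longleftrightarrow> (\<exists>Ls. (\<forall>L\<in>set Ls. literal L) \<and> C = Disj Ls)"


section \<open>Semantics modulo a theory\<close>

record ('f, 'r, 'u) struct =
  univ :: "'u set"
  fun_int :: "'f \<Rightarrow> 'u list \<Rightarrow> 'u"
  rel_int :: "'r \<Rightarrow> 'u list \<Rightarrow> bool"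

definition is_struct :: "('f, 'r, 'u) struct \<Rightarrow> bool" where
  "is_struct M \<longleftrightarrow> univ M \<noteq> {} \<and> (\<forall>f xs. set xs \<subseteq> univ M \<longrightarrow> fun_int M f xs \<in> univ M)"

text \<open>
  A theory is given semantically, by its class of models. The theory axiomatised by a set of
  sentences is the special case of all structures satisfying these sentences.
\<close>
type_synonym ('f, 'r, 'u) fo_theory = "('f, 'r, 'u) struct set"

definition is_theory :: "('f, 'r, 'u) fo_theory \<Rightarrow> bool" where
  "is_theory T \<longleftrightarrow> (\<forall>M\<in>T. is_struct M)"

primrec trm_val :: "('f, 'r, 'u) struct \<Rightarrow> ('v \<Rightarrow> 'u) \<Rightarrow> ('f, 'v) trm \<Rightarrow> 'u" where
  "trm_val M s (Var x) = s x"
| "trm_val M s (Fun f ts) = fun_int M f (map (trm_val M s) ts)"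

primrec theory_atom_val ::
    "('f, 'r, 'u) struct \<Rightarrow> ('v \<Rightarrow> 'u) \<Rightarrow> ('f, 'r, 'v) theory_atom \<Rightarrow> bool" where
  "theory_atom_val M s (Rel r ts) \<longleftrightarrow> rel_int M r (map (trm_val M s) ts)"
| "theory_atom_val M s (Eq t u) \<longleftrightarrow> trm_val M s t = trm_val M s u"

primrec atom_val ::
    "('f, 'r, 'u) struct \<Rightarrow> ('v \<Rightarrow> 'u) \<Rightarrow> ('b \<Rightarrow> bool) \<Rightarrow> ('f, 'r, 'v, 'b) atom \<Rightarrow> bool" where
  "atom_val M s \<beta> (TAtom A) \<longleftrightarrow> theory_atom_val M s A"
| "atom_val M s \<beta> (BAtom B) \<longleftrightarrow> \<beta> B"

definition T_satisfiable :: "('f, 'r, 'u) fo_theory \<Rightarrow> ('f, 'r, 'v, 'b) tform \<Rightarrow> bool" where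
  "T_satisfiable T F \<longleftrightarrow> (\<exists>M\<in>T. \<exists>s \<beta>. range s \<subseteq> univ M \<and> eval (atom_val M s \<beta>) F)"

definition T_valid :: "('f, 'r, 'u) fo_theory \<Rightarrow> ('f, 'r, 'v, 'b) tform \<Rightarrow> bool" where
  "T_valid T F \<longleftrightarrow> (\<forall>M\<in>T. \<forall>s \<beta>. range s \<subseteq> univ M \<longrightarrow> eval (atom_val M s \<beta>) F)"

definition T_equiv ::
    "('f, 'r, 'u) fo_theory \<Rightarrow> ('f, 'r, 'v, 'b) tform \<Rightarrow> ('f, 'r, 'v, 'b) tform \<Rightarrow> bool" where
  "T_equiv T F G \<longleftrightarrow> (\<forall>M\<in>T. \<forall>s \<beta>. range s \<subseteq> univ M \<longrightarrow>
     (eval (atom_val M s \<beta>) F \<longleftrightarrow> eval (atom_val M s \<beta>) G))"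

definition T_lemma :: "('f, 'r, 'u) fo_theory \<Rightarrow> ('f, 'r, 'v, 'b) tform \<Rightarrow> bool" where
  "T_lemma T C \<longleftrightarrow> clause C \<and> T_valid T C"


section \<open>Boolean abstraction\<close>

text \<open>The constructor is the bijection between atoms and Boolean variables.\<close>
datatype 'a boolvar = BVar 'a

definition bool_abs :: "('f, 'r, 'v, 'b) tform \<Rightarrow> ('f, 'r, 'v, 'b) atom boolvar form" where
  "bool_abs F = map_form BVar F"

definition prop_entails ::
    "('f, 'r, 'v, 'b) tform \<Rightarrow> ('f, 'r, 'v, 'b) tform \<Rightarrow> bool" (infix \<open>\<Turnstile>\<^sub>p\<close> 50) where
  "F \<Turnstile>\<^sub>p G \<longleftrightarrow> (\<forall>\<mu>. eval \<mu> (bool_abs F) \<longrightarrow> eval \<mu> (bool_abs G))"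


section \<open>Reduction modulo a theory\<close>

text \<open>The order of the conjuncts is left open; repeated conjuncts are not allowed.\<close>
definition total_assignment :: "'a set \<Rightarrow> 'a form \<Rightarrow> bool" where
  "total_assignment \<alpha> \<rho> \<longleftrightarrow> (\<exists>Ls. distinct Ls \<and> \<rho> = Conj Ls \<and>
     (\<forall>L\<in>set Ls. \<exists>a\<in>\<alpha>. L = Atom a \<or> L = Neg (Atom a)) \<and>
     (\<forall>a\<in>\<alpha>. Atom a \<in> set Ls \<longleftrightarrow> Neg (Atom a) \<notin> set Ls))"

definition P_set ::
    "('f, 'r, 'u) fo_theory \<Rightarrow> ('f, 'r, 'v, 'b) atom set \<Rightarrow> ('f, 'r, 'v, 'b) tform \<Rightarrow>
     ('f, 'r, 'v, 'b) tform set" where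
  "P_set T \<alpha> \<psi> = {\<rho>. total_assignment \<alpha> \<rho> \<and> \<not> T_satisfiable T \<rho> \<and> \<rho> \<Turnstile>\<^sub>p \<psi>}"

definition rules_out :: "('f, 'r, 'v, 'b) tform set \<Rightarrow> ('f, 'r, 'v, 'b) tform set \<Rightarrow> bool" where
  "rules_out \<C> R \<longleftrightarrow> (\<forall>\<rho>\<in>R. \<exists>C\<in>\<C>. \<rho> \<Turnstile>\<^sub>p Neg C)"

definition T_reduced ::
    "('f, 'r, 'u) fo_theory \<Rightarrow> ('f, 'r, 'v, 'b) atom set \<Rightarrow> ('f, 'r, 'v, 'b) tform \<Rightarrow> bool" where
  "T_reduced T \<alpha> \<psi> \<longleftrightarrow> P_set T \<alpha> \<psi> = {}"

definition Tred :: "'a form list \<Rightarrow> 'a form \<Rightarrow> 'a form" where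
  "Tred Cs \<phi> = And \<phi> (Conj Cs)"

end

theory Submission
  imports Defs
begin

text \<open>
  A total truth assignment is propositionally consistent. Hence, if it entails the conjunction
  of \<open>\<phi>\<close> with all the lemmas, no lemma can rule it out, although it entails \<open>\<phi>\<close>; so it
  is satisfiable modulo the theory.
\<close>

lemma eval_Conj: "eval \<mu> (Conj Fs) \<longleftrightarrow> (\<forall>F\<in>set Fs. eval \<mu> F)"
  by (induction Fs) (auto simp: Conj_def)

lemma eval_Tred: "eval \<mu> (Tred Cs \<phi>) \<longleftrightarrow> eval \<mu> \<phi> \<and> (\<forall>C\<in>set Cs. eval \<mu> C)"
  by (simp add: Tred_def eval_Conj)

lemma eval_map_form: "eval \<mu> (map_form f F) \<longleftrightarrow> eval (\<mu> \<circ> f) F"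
  by (induction F) auto

text \<open>The abstraction merely renames atoms injectively, so every valuation of the atoms is
  induced by one of the Boolean variables. Entailment can then be checked on the atoms
  directly.\<close>

lemma prop_entails_iff: "F \<Turnstile>\<^sub>p G \<longleftrightarrow> (\<forall>\<mu>. eval \<mu> F \<longrightarrow> eval \<mu> G)"
proof
  assume entails: "F \<Turnstile>\<^sub>p G"
  \<comment> \<open>\<open>case_boolvar id\<close> is the inverse of \<open>BVar\<close>.\<close>
  have "\<mu> = (\<mu> \<circ> case_boolvar id) \<circ> BVar" for \<mu> :: "('a, 'b, 'c, 'd) atom \<Rightarrow> bool"
    by (simp add: fun_eq_iff)
  with entails show "\<forall>\<mu>. eval \<mu> F \<longrightarrow> eval \<mu> G"
    unfolding prop_entails_def bool_abs_def eval_map_form by metis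
qed (simp add: prop_entails_def bool_abs_def eval_map_form)

text \<open>Needed because an inconsistent formula would entail both a lemma and its negation
  without any contradiction.\<close>

lemma total_assignment_consistent:
  assumes "total_assignment \<alpha> \<rho>"
  obtains \<mu> where "eval \<mu> \<rho>"
proof -
  from assms obtain Ls where Ls: "\<rho> = Conj Ls"
      "\<forall>L\<in>set Ls. \<exists>a\<in>\<alpha>. L = Atom a \<or> L = Neg (Atom a)"
      "\<forall>a\<in>\<alpha>. Atom a \<in> set Ls \<longleftrightarrow> Neg (Atom a) \<notin> set Ls"
    unfolding total_assignment_def by blast
  \<comment> \<open>Exactly the atoms occurring positively are made true; a negated atom in
    \<open>Ls\<close> is false since it cannot also occur positively.\<close>
  have "eval (\<lambda>a. Atom a \<in> set Ls) \<rho>"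
    unfolding Ls(1) eval_Conj using Ls(2,3) by fastforce
  then show thesis by (rule that)
qed

lemma T_equiv_Tred:
  assumes "\<forall>C\<in>set Cs. T_valid T C"
  shows "T_equiv T (Tred Cs \<phi>) \<phi>"
  using assms by (auto simp: T_equiv_def T_valid_def eval_Tred)

lemma Tred_entails: "Tred Cs \<phi> \<Turnstile>\<^sub>p \<phi>"
  by (simp add: prop_entails_iff eval_Tred)

lemma T_reduced_Tred:
  assumes "rules_out (set Cs) (P_set T \<alpha> \<phi>)"
  shows "T_reduced T \<alpha> (Tred Cs \<phi>)"
  unfolding T_reduced_def
proof (rule equals0I)
  fix \<rho> assume \<rho>: "\<rho> \<in> P_set T \<alpha> (Tred Cs \<phi>)"
  then have entails: "\<forall>\<mu>. eval \<mu> \<rho> \<longrightarrow> eval \<mu> \<phi> \<and> (\<forall>C\<in>set Cs. eval \<mu> C)"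
    by (simp add: P_set_def prop_entails_iff eval_Tred)
  \<comment> \<open>Entailing the stronger formula implies entailing \<phi>, so the rule-out
    hypothesis applies to \<rho>.\<close>
  with \<rho> have "\<rho> \<in> P_set T \<alpha> \<phi>"
    by (simp add: P_set_def prop_entails_iff)
  with assms obtain C where C: "C \<in> set Cs" "\<forall>\<mu>. eval \<mu> \<rho> \<longrightarrow> \<not> eval \<mu> C"
    by (auto simp: rules_out_def prop_entails_iff)
  from \<rho> obtain \<mu> where "eval \<mu> \<rho>"
    by (auto simp: P_set_def elim: total_assignment_consistent)
  \<comment> \<open>Under \<mu> the lemma \<open>C\<close> is true as a conjunct of
    \<open>Tred Cs \<phi>\<close> and false because it rules out \<rho>.\<close>
  with entails C show False by blast
qed

theorem theorem4p11:
  fixes T :: "('f, 'r, 'u) fo_theory"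
    and \<phi> :: "('f, 'r, 'v, 'b) tform"
    and \<alpha> :: "('f, 'r, 'v, 'b) atom set"
    and Cs :: "('f, 'r, 'v, 'b) tform list"
  assumes "is_theory T"
    and "finite \<alpha>"
    and "atoms_of \<phi> \<subseteq> \<alpha>"
    and "\<forall>C\<in>set Cs. T_lemma T C \<and> atoms_of C \<subseteq> \<alpha>"
    and "rules_out (set Cs) (P_set T \<alpha> \<phi>)"
  shows "T_equiv T (Tred Cs \<phi>) \<phi> \<and> Tred Cs \<phi> \<Turnstile>\<^sub>p \<phi> \<and> T_reduced T \<alpha> (Tred Cs \<phi>)"
  using assms(4,5) by (simp add: T_lemma_def T_equiv_Tred Tred_entails T_reduced_Tred)

end
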